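(* Let $G=(V,E,\nu,\mu)$ be an infinite weighted graph, and let $\Gamma$ be a subgroup of the automorphism group $\mathrm{Aut}(G)$ which acts finitely on $G$. Then $$h(G)=h(G/\Gamma),\qquad h_\infty(G)=h_\infty(G/\Gamma).$$
   Context: A weighted graph $G=(V,E,\nu,\mu)$ consists of a locally finite, simple, undirected graph $(V,E)$, an edge weight $\mu:E\to(0,\infty)$, $\{x,y\}\mapsto\mu_{xy}=\mu_{yx}$, extended by $\mu_{xy}=0$ if $\{x,y\}\notin E$, and a vertex measure $\nu:V\to(0,\infty)$, $x\mapsto\nu_x$. Infinite graphs are assumed to have countable vertex set (so that exhaustions, below, exist). An automorphism of $G$ is a graph isomorphism $g:V\to V$ with $\mu_{g(x)g(y)}=\mu_{xy}$ and $\nu_{g(x)}=\nu_x$ for all $x,y\in V$; these form the group $\mathrm{Aut}(G)$. A subgroup $\Gamma$ acts finitely on $G$ if each $\Gamma$-orbit consists of finitely many vertices. $[x]$ denotes the $\Gamma$-orbit of $x$. The quotient graph $G/\Gamma$ is the weighted graph whose vertices are the $\Gamma$-orbits; two different orbits $[x],[y]$ are adjacent if there are $x'\in[x]$, $y'\in[y]$ with $x'\sim y'$; the edge weight is $\mu_{[x][y]}=\sum_{x_1\in[x],\,y_1\in[y]}\mu_{x_1y_1}$ for $[x]\neq[y]$ and the vertex weight is $\nu_{[x]}=\sum_{x_1\in[x]}\nu_{x_1}$. There are no self-loops in $G/\Gamma$ (edges inside an orbit are discarded). For $U\subset V$, $\partial U=\{\{x,y\}\in E:x\in U,\,y\in V\setminus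 U\}$, $|\partial U|_\mu=\sum_{\{x,y\}\in\partial U}\mu_{xy}$, $|U|_\nu=\sum_{x\in U}\nu_x$. For a finite nonempty $\Omega\subset V$, $h(\Omega)=h_{\mu,\nu}(\Omega)=\min_{\emptyset\neq U\subset\Omega}|\partial U|_\mu/|U|_\nu$. For an infinite weighted graph, let $\{\Omega_i\}_{i\ge1}$ be an exhaustion: finite subsets with $\Omega_i\subset\Omega_{i+1}$ and $V=\bigcup_i\Omega_i$. Define $$h(G)=\lim_{i\to\infty}h(\Omega_i),\qquad h_\infty(G)=\lim_{i\to\infty}\lim_{j\to\infty}h(\Omega_j\setminus\Omega_i)\in[0,\infty],$$ which do not depend on the choice of exhaustion. *)

theory Defs
  imports
    "HOL-Analysis.Analysis"
    "HOL-Algebra.Group_Action"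
begin

section \<open>Weighted graphs\<close>

record 'a weighted_graph =
  verts :: "'a set"
  edges :: "'a set set"
  vweight :: "'a \<Rightarrow> real"
  eweight :: "'a \<Rightarrow> 'a \<Rightarrow> real"

text \<open>\<open>eweight G x y\<close> is the weight of the edge joining \<open>x\<close> and \<open>y\<close>, already extended
  by zero to pairs of non-adjacent vertices.\<close>

locale weighted_graph =
  fixes G :: "'a weighted_graph"
  assumes simple: "e \<in> edges G \<Longrightarrow> \<exists>x\<in>verts G. \<exists>y\<in>verts G. x \<noteq> y \<and> e = {x, y}"
    and locally_finite: "x \<in> verts G \<Longrightarrow> finite {y. {x, y} \<in> edges G}"
    and eweight_sym: "\<lbrakk>x \<in> verts G; y \<in> verts G\<rbrakk> \<Longrightarrow> eweight G x y = eweight G y x"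
    and eweight_pos: "{x, y} \<in> edges G \<Longrightarrow> eweight G x y > 0"
    and eweight_zero: "\<lbrakk>x \<in> verts G; y \<in> verts G; {x, y} \<notin> edges G\<rbrakk> \<Longrightarrow> eweight G x y = 0"
    and vweight_pos: "x \<in> verts G \<Longrightarrow> vweight G x > 0"

locale infinite_weighted_graph = weighted_graph +
  assumes countable_verts: "countable (verts G)"
    and infinite_verts: "infinite (verts G)"


section \<open>Automorphisms and quotients\<close>

text \<open>As in \<^theory>\<open>HOL-Algebra.Bij\<close>, permutations of the vertex set are extensional functions,
  so that each automorphism has a unique representative.\<close>

definition graph_auto :: "'a weighted_graph \<Rightarrow> ('a \<Rightarrow> 'a) set" where
  "graph_auto G = {g \<in> Bij (verts G).
     (\<forall>x\<in>verts G. \<forall>y\<in>verts G. {g x, g y} \<in> edges G \<longleftrightarrow> {x, y} \<in> edges G) \<and>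
     (\<forall>x\<in>verts G. \<forall>y\<in>verts G. eweight G (g x) (g y) = eweight G x y) \<and>
     (\<forall>x\<in>verts G. vweight G (g x) = vweight G x)}"

definition graph_AutoGroup :: "'a weighted_graph \<Rightarrow> ('a \<Rightarrow> 'a) monoid" where
  "graph_AutoGroup G = BijGroup (verts G) \<lparr>carrier := graph_auto G\<rparr>"

definition vertex_orbits :: "'a weighted_graph \<Rightarrow> ('a \<Rightarrow> 'a) set \<Rightarrow> 'a set set" where
  "vertex_orbits G \<Gamma> = orbits (graph_AutoGroup G \<lparr>carrier := \<Gamma>\<rparr>) (verts G) id"

definition acts_finitely :: "('a \<Rightarrow> 'a) set \<Rightarrow> 'a weighted_graph \<Rightarrow> bool" where
  "acts_finitely \<Gamma> G \<longleftrightarrow> (\<forall>A\<in>vertex_orbits G \<Gamma>. finite A)"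

definition quotient_graph ::
    "'a weighted_graph \<Rightarrow> ('a \<Rightarrow> 'a) set \<Rightarrow> 'a set weighted_graph" where
  "quotient_graph G \<Gamma> =
    \<lparr>verts = vertex_orbits G \<Gamma>,
     edges = {{A, B} | A B. A \<in> vertex_orbits G \<Gamma> \<and> B \<in> vertex_orbits G \<Gamma> \<and> A \<noteq> B \<and>
                (\<exists>x\<in>A. \<exists>y\<in>B. {x, y} \<in> edges G)},
     vweight = (\<lambda>A. \<Sum>x\<in>A. vweight G x),
     eweight = (\<lambda>A B. if A = B then 0 else \<Sum>x\<in>A. \<Sum>y\<in>B. eweight G x y)\<rparr>"


section \<open>Cheeger constants\<close>

definition edge_boundary :: "'a weighted_graph \<Rightarrow> 'a set \<Rightarrow> 'a set set" where
  "edge_boundary G U = {{x, y} | x y. {x, y} \<in> edges G \<and> x \<in> U \<and> y \<in> verts G - U}"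

text \<open>The weight of an unordered edge; the description is unique because
  \<open>eweight\<close> is symmetric.\<close>

definition edge_weight :: "'a weighted_graph \<Rightarrow> 'a set \<Rightarrow> real" where
  "edge_weight G e = (THE w. \<exists>x y. e = {x, y} \<and> w = eweight G x y)"

definition boundary_size :: "'a weighted_graph \<Rightarrow> 'a set \<Rightarrow> real" where
  "boundary_size G U = (\<Sum>e\<in>edge_boundary G U. edge_weight G e)"

definition vertex_size :: "'a weighted_graph \<Rightarrow> 'a set \<Rightarrow> real" where
  "vertex_size G U = (\<Sum>x\<in>U. vweight G x)"

text \<open>Meaningful for finite nonempty \<open>\<Omega>\<close> only; below, \<open>\<Omega>\<close> is empty for at most finitely
  many terms of each sequence.\<close>

definition cheeger_on :: "'a weighted_graph \<Rightarrow> 'a set \<Rightarrow> real" where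
  "cheeger_on G \<Omega> = Min ((\<lambda>U. boundary_size G U / vertex_size G U) ` {U. U \<noteq> {} \<and> U \<subseteq> \<Omega>})"

definition exhaustion :: "'a weighted_graph \<Rightarrow> (nat \<Rightarrow> 'a set) \<Rightarrow> bool" where
  "exhaustion G \<Omega> \<longleftrightarrow>
     (\<forall>i. finite (\<Omega> i)) \<and> (\<forall>i. \<Omega> i \<subseteq> \<Omega> (Suc i)) \<and> (\<Union>i. \<Omega> i) = verts G"

text \<open>Both constants are the common value of the limits along all exhaustions; that such a
  value exists and is unique is shown below, in \<open>cheeger_limit\<close> and \<open>cheeger_infinity_limit\<close>.\<close>

definition cheeger :: "'a weighted_graph \<Rightarrow> real" where
  "cheeger G = (THE c. \<forall>\<Omega>. exhaustion G \<Omega> \<longrightarrow> (\<lambda>i. cheeger_on G (\<Omega> i)) \<longlonglongrightarrow> c)"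

definition cheeger_infinity :: "'a weighted_graph \<Rightarrow> ereal" where
  "cheeger_infinity G = (THE c. \<forall>\<Omega>. exhaustion G \<Omega> \<longrightarrow>
     (\<exists>L :: nat \<Rightarrow> real. (\<forall>i. (\<lambda>j. cheeger_on G (\<Omega> j - \<Omega> i)) \<longlonglongrightarrow> L i) \<and>
        (\<lambda>i. ereal (L i)) \<longlonglongrightarrow> c))"


section \<open>The definitions are meaningful\<close>

lemma exhaustion_finite: "exhaustion G \<Omega> \<Longrightarrow> finite (\<Omega> i)"
  and exhaustion_subset: "exhaustion G \<Omega> \<Longrightarrow> \<Omega> i \<subseteq> verts G"
  unfolding exhaustion_def by blast+

lemma exhaustion_mono: "exhaustion G \<Omega> \<Longrightarrow> i \<le> j \<Longrightarrow> \<Omega> i \<subseteq> \<Omega> j"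
  by (rule lift_Suc_mono_le) (simp_all add: exhaustion_def)

lemma exhaustion_eventually:
  assumes ex: "exhaustion G \<Omega>" and "finite W" "W \<subseteq> verts G"
  shows "\<exists>N. \<forall>n\<ge>N. W \<subseteq> \<Omega> n"
  using assms(2,3)
proof (induction W)
  case (insert x W)
  then obtain N where N: "\<And>n. n \<ge> N \<Longrightarrow> W \<subseteq> \<Omega> n" by auto
  have "x \<in> (\<Union>i. \<Omega> i)" using insert.prems ex by (simp add: exhaustion_def)
  then obtain M where M: "x \<in> \<Omega> M" by (rule UN_E)
  have "insert x W \<subseteq> \<Omega> n" if "n \<ge> max N M" for n
  proof -
    have "x \<in> \<Omega> n" using exhaustion_mono[OF ex, of M n] M that by auto
    then show ?thesis using N[of n] that by simp
  qed
  then show ?case by blast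
qed simp

lemma subgroup_graph_auto: "subgroup (graph_auto G) (BijGroup (verts G))"
proof (rule group.subgroupI[OF group_BijGroup])
  show "graph_auto G \<subseteq> carrier (BijGroup (verts G))"
    by (auto simp: graph_auto_def BijGroup_def)
  have "(\<lambda>x\<in>verts G. x) \<in> graph_auto G" by (simp add: graph_auto_def id_Bij)
  then show "graph_auto G \<noteq> {}" by blast
next
  fix g assume g: "g \<in> graph_auto G"
  then have bij: "g \<in> Bij (verts G)" by (simp add: graph_auto_def)
  let ?h = "inv_into (verts G) g"
  have h: "?h x \<in> verts G" "g (?h x) = x" if "x \<in> verts G" for x
    using that Bij_inv_into_mem[OF bij that] bij by (auto simp: Bij_def bij_betw_inv_into_right)
  have e: "{g x, g y} \<in> edges G \<longleftrightarrow> {x, y} \<in> edges G"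
    and w: "eweight G (g x) (g y) = eweight G x y" and v: "vweight G (g x) = vweight G x"
    if "x \<in> verts G" "y \<in> verts G" for x y
    using g that by (auto simp: graph_auto_def)
  show "inv\<^bsub>BijGroup (verts G)\<^esub> g \<in> graph_auto G"
    unfolding inv_BijGroup[OF bij] graph_auto_def mem_Collect_eq
  proof (intro conjI ballI restrict_inv_into_Bij bij)
    fix x y assume xy: "x \<in> verts G" "y \<in> verts G"
    show "{restrict ?h (verts G) x, restrict ?h (verts G) y} \<in> edges G \<longleftrightarrow> {x, y} \<in> edges G"
      using e[of "?h x" "?h y"] h xy by simp
    show "eweight G (restrict ?h (verts G) x) (restrict ?h (verts G) y) = eweight G x y"
      using w[of "?h x" "?h y"] h xy by simp
  next
    fix x assume x: "x \<in> verts G"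
    show "vweight G (restrict ?h (verts G) x) = vweight G x"
      using v[of "?h x" "?h x"] h x by simp
  qed
next
  fix f g assume fg: "f \<in> graph_auto G" "g \<in> graph_auto G"
  then have bij: "f \<in> Bij (verts G)" "g \<in> Bij (verts G)" by (simp_all add: graph_auto_def)
  have "g x \<in> verts G" if "x \<in> verts G" for x
    using Bij_imp_funcset[OF bij(2)] that by auto
  then have "compose (verts G) f g \<in> graph_auto G"
    using fg compose_Bij[OF bij] by (simp add: graph_auto_def compose_eq)
  then show "f \<otimes>\<^bsub>BijGroup (verts G)\<^esub> g \<in> graph_auto G"
    using bij by (simp add: BijGroup_def)
qed

lemma group_graph_AutoGroup: "group (graph_AutoGroup G)"
  unfolding graph_AutoGroup_def
  by (rule subgroup.subgroup_is_group[OF subgroup_graph_auto group_BijGroup])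

lemma subgroup_action:
  assumes "subgroup \<Gamma> (graph_AutoGroup G)"
  shows "group_action (graph_AutoGroup G \<lparr>carrier := \<Gamma>\<rparr>) (verts G) id"
proof -
  have "subgroup \<Gamma> (BijGroup (verts G))"
    using group.incl_subgroup[OF group_BijGroup subgroup_graph_auto] assms
    by (simp add: graph_AutoGroup_def)
  from group.canonical_inj_is_hom[OF group_BijGroup this] show ?thesis
    by (simp add: group_action_def graph_AutoGroup_def)
qed

context weighted_graph
begin

lemma edge_verts: "{x, y} \<in> edges G \<Longrightarrow> x \<in> verts G \<and> y \<in> verts G \<and> x \<noteq> y"
  using simple[of "{x, y}"] by (auto simp: doubleton_eq_iff)

lemma edge_weight_eq: "{x, y} \<in> edges G \<Longrightarrow> edge_weight G {x, y} = eweight G x y"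
  unfolding edge_weight_def
  by (rule the_equality) (auto simp: doubleton_eq_iff eweight_sym dest: edge_verts)

lemma finite_edge_boundary:
  assumes "finite U" "U \<subseteq> verts G"
  shows "finite (edge_boundary G U)"
proof (rule finite_subset)
  show "edge_boundary G U \<subseteq> (\<Union>x\<in>U. (\<lambda>y. {x, y}) ` {y. {x, y} \<in> edges G})"
    by (auto simp: edge_boundary_def)
  show "finite (\<Union>x\<in>U. (\<lambda>y. {x, y}) ` {y. {x, y} \<in> edges G})"
    using assms locally_finite by auto
qed

lemma boundary_size_nonneg: "boundary_size G U \<ge> 0"
  unfolding boundary_size_def
  by (rule sum_nonneg)
    (auto simp: edge_boundary_def edge_weight_eq intro!: less_imp_le[OF eweight_pos])

lemma vertex_size_nonneg: "U \<subseteq> verts G \<Longrightarrow> vertex_size G U \<ge> 0"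
  unfolding vertex_size_def by (rule sum_nonneg) (auto intro!: less_imp_le[OF vweight_pos])

lemma finite_ratios: "finite W \<Longrightarrow> finite ((\<lambda>U. f U :: real) ` {U. U \<noteq> {} \<and> U \<subseteq> W})"
  by (rule finite_imageI, rule finite_subset[of _ "Pow W"]) auto

lemma cheeger_on_nonneg:
  assumes "finite W" "W \<noteq> {}" "W \<subseteq> verts G"
  shows "cheeger_on G W \<ge> 0"
  unfolding cheeger_on_def using assms
  by (subst Min_ge_iff)
    (auto intro!: finite_ratios divide_nonneg_nonneg boundary_size_nonneg vertex_size_nonneg)

lemma cheeger_on_antimono:
  assumes "finite W'" "W \<noteq> {}" "W \<subseteq> W'"
  shows "cheeger_on G W' \<le> cheeger_on G W"
  unfolding cheeger_on_def using assms
  by (intro Min_antimono finite_ratios image_mono) auto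

end

context infinite_weighted_graph
begin

lemma exhaustion_exists: "\<exists>\<Omega>. exhaustion G \<Omega>"
proof -
  have "verts G \<noteq> {}" using infinite_verts by auto
  then have "range (from_nat_into (verts G)) = verts G"
    using countable_verts by (rule range_from_nat_into)
  moreover have "(\<Union>i::nat. f ` {..i}) = range f" for f :: "nat \<Rightarrow> 'a" by blast
  ultimately have "exhaustion G (\<lambda>i. from_nat_into (verts G) ` {..i})"
    by (simp add: exhaustion_def image_mono)
  then show ?thesis by blast
qed

definition outer_sets :: "'a set \<Rightarrow> 'a set set" where
  "outer_sets K = {W. finite W \<and> W \<noteq> {} \<and> W \<subseteq> verts G - K}"

definition outer_inf :: "'a set \<Rightarrow> real" where
  "outer_inf K = Inf (cheeger_on G ` outer_sets K)"

lemma outer_sets_nonempty: "finite K \<Longrightarrow> outer_sets K \<noteq> {}"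
proof -
  assume "finite K"
  then have "infinite (verts G - K)" using infinite_verts by simp
  then obtain x where "x \<in> verts G - K" by (metis ex_in_conv finite.emptyI)
  then have "{x} \<in> outer_sets K" by (auto simp: outer_sets_def)
  then show ?thesis by auto
qed

lemma outer_bdd: "bdd_below (cheeger_on G ` outer_sets K)"
  by (rule bdd_belowI[of _ 0]) (auto simp: outer_sets_def intro!: cheeger_on_nonneg)

lemma outer_inf_mono: "finite K' \<Longrightarrow> K \<subseteq> K' \<Longrightarrow> outer_inf K \<le> outer_inf K'"
  unfolding outer_inf_def
  by (intro cInf_superset_mono outer_bdd image_mono)
    (use outer_sets_nonempty in \<open>auto simp: outer_sets_def\<close>)

lemma outer_limit:
  assumes ex: "exhaustion G \<Omega>" and K: "finite K"
  shows "(\<lambda>j. cheeger_on G (\<Omega> j - K)) \<longlonglongrightarrow> outer_inf K"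
proof (rule LIMSEQ_I)
  fix r :: real assume "r > 0"
  then obtain W where W: "W \<in> outer_sets K" and lt: "cheeger_on G W < outer_inf K + r"
    using cInf_lessD[of "cheeger_on G ` outer_sets K" "outer_inf K + r"] outer_sets_nonempty[OF K]
    unfolding outer_inf_def by auto
  obtain N where N: "\<forall>n\<ge>N. W \<subseteq> \<Omega> n"
    using exhaustion_eventually[OF ex, of W] W by (auto simp: outer_sets_def)
  have "norm (cheeger_on G (\<Omega> n - K) - outer_inf K) < r" if "n \<ge> N" for n
  proof -
    have sub: "W \<subseteq> \<Omega> n - K" "W \<noteq> {}" using N that W by (auto simp: outer_sets_def)
    then have "cheeger_on G (\<Omega> n - K) \<le> cheeger_on G W"
      using exhaustion_finite[OF ex] by (intro cheeger_on_antimono) auto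
    moreover have "\<Omega> n - K \<in> outer_sets K"
      using sub exhaustion_finite[OF ex] exhaustion_subset[OF ex] by (auto simp: outer_sets_def)
    then have "outer_inf K \<le> cheeger_on G (\<Omega> n - K)"
      unfolding outer_inf_def by (intro cInf_lower outer_bdd) auto
    ultimately show ?thesis using lt by auto
  qed
  then show "\<exists>N. \<forall>n\<ge>N. norm (cheeger_on G (\<Omega> n - K) - outer_inf K) < r" by blast
qed

lemma outer_limit_limit:
  assumes ex: "exhaustion G \<Omega>"
  shows "(\<lambda>i. ereal (outer_inf (\<Omega> i))) \<longlonglongrightarrow>
           (SUP K\<in>{K. finite K \<and> K \<subseteq> verts G}. ereal (outer_inf K))"
proof -
  have "(\<lambda>i. ereal (outer_inf (\<Omega> i))) \<longlonglongrightarrow> (SUP i. ereal (outer_inf (\<Omega> i)))"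
    using exhaustion_finite[OF ex] exhaustion_mono[OF ex]
    by (intro LIMSEQ_SUP) (simp add: incseq_def outer_inf_mono)
  also have "(SUP i. ereal (outer_inf (\<Omega> i))) =
      (SUP K\<in>{K. finite K \<and> K \<subseteq> verts G}. ereal (outer_inf K))"
  proof (rule antisym)
    show "(SUP i. ereal (outer_inf (\<Omega> i))) \<le>
        (SUP K\<in>{K. finite K \<and> K \<subseteq> verts G}. ereal (outer_inf K))"
      by (rule SUP_mono) (use exhaustion_finite[OF ex] exhaustion_subset[OF ex] in blast)
    show "(SUP K\<in>{K. finite K \<and> K \<subseteq> verts G}. ereal (outer_inf K)) \<le>
        (SUP i. ereal (outer_inf (\<Omega> i)))"
    proof (rule SUP_mono)
      fix K assume "K \<in> {K. finite K \<and> K \<subseteq> verts G}"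
      then obtain n where "K \<subseteq> \<Omega> n" using exhaustion_eventually[OF ex, of K] by auto
      then show "\<exists>m\<in>UNIV. ereal (outer_inf K) \<le> ereal (outer_inf (\<Omega> m))"
        using outer_inf_mono[OF exhaustion_finite[OF ex]] by auto
    qed
  qed
  finally show ?thesis .
qed

theorem cheeger_limit:
  assumes "exhaustion G \<Omega>"
  shows "(\<lambda>i. cheeger_on G (\<Omega> i)) \<longlonglongrightarrow> cheeger G"
proof -
  have lim: "(\<lambda>i. cheeger_on G (\<Omega>' i)) \<longlonglongrightarrow> outer_inf {}" if "exhaustion G \<Omega>'" for \<Omega>'
    using outer_limit[OF that, of "{}"] by simp
  have "cheeger G = outer_inf {}"
    unfolding cheeger_def using lim exhaustion_exists
    by (intro the_equality) (auto intro: LIMSEQ_unique)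
  then show ?thesis using lim[OF assms] by simp
qed

theorem cheeger_infinity_limit:
  assumes "exhaustion G \<Omega>"
  shows "\<exists>L :: nat \<Rightarrow> real. (\<forall>i. (\<lambda>j. cheeger_on G (\<Omega> j - \<Omega> i)) \<longlonglongrightarrow> L i) \<and>
           (\<lambda>i. ereal (L i)) \<longlonglongrightarrow> cheeger_infinity G"
proof -
  let ?S = "SUP K\<in>{K. finite K \<and> K \<subseteq> verts G}. ereal (outer_inf K)"
  let ?P = "\<lambda>c \<Omega>. \<exists>L :: nat \<Rightarrow> real.
    (\<forall>i. (\<lambda>j. cheeger_on G (\<Omega> j - \<Omega> i)) \<longlonglongrightarrow> L i) \<and> (\<lambda>i. ereal (L i)) \<longlonglongrightarrow> c"
  have P: "?P ?S \<Omega>'" if ex: "exhaustion G \<Omega>'" for \<Omega>'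
  proof (rule exI, rule conjI)
    show "\<forall>i. (\<lambda>j. cheeger_on G (\<Omega>' j - \<Omega>' i)) \<longlonglongrightarrow> outer_inf (\<Omega>' i)"
      using outer_limit[OF ex exhaustion_finite[OF ex]] by simp
  qed (rule outer_limit_limit[OF ex])
  have uniq: "c = ?S" if ex: "exhaustion G \<Omega>'" and c: "?P c \<Omega>'" for c \<Omega>'
  proof -
    from c obtain L where L: "\<And>i. (\<lambda>j. cheeger_on G (\<Omega>' j - \<Omega>' i)) \<longlonglongrightarrow> L i"
      and lim: "(\<lambda>i. ereal (L i)) \<longlonglongrightarrow> c" by blast
    have "L = (\<lambda>i. outer_inf (\<Omega>' i))"
      using LIMSEQ_unique[OF L outer_limit[OF ex exhaustion_finite[OF ex]]] by auto
    with lim have "(\<lambda>i. ereal (outer_inf (\<Omega>' i))) \<longlonglongrightarrow> c" by simp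
    then show ?thesis by (rule LIMSEQ_unique[OF _ outer_limit_limit[OF ex]])
  qed
  have "cheeger_infinity G = ?S"
    unfolding cheeger_infinity_def
  proof (rule the_equality)
    show "\<forall>\<Omega>. exhaustion G \<Omega> \<longrightarrow> ?P ?S \<Omega>" using P by simp
    obtain \<Omega>' where ex: "exhaustion G \<Omega>'" using exhaustion_exists ..
    fix c assume "\<forall>\<Omega>. exhaustion G \<Omega> \<longrightarrow> ?P c \<Omega>"
    then have "?P c \<Omega>'" using ex by simp
    then show "c = ?S" by (rule uniq[OF ex])
  qed
  then show ?thesis using P[OF assms] by simp
qed

theorem infinite_weighted_graph_quotient:
  assumes sub: "subgroup \<Gamma> (graph_AutoGroup G)" and fin: "acts_finitely \<Gamma> G"
  shows "infinite_weighted_graph (quotient_graph G \<Gamma>)"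
proof -
  let ?O = "vertex_orbits G \<Gamma>"
  define orb where "orb = orbit (graph_AutoGroup G \<lparr>carrier := \<Gamma>\<rparr>) id"
  interpret act: group_action "graph_AutoGroup G \<lparr>carrier := \<Gamma>\<rparr>" "verts G" id
    by (rule subgroup_action[OF sub])
  have O: "?O = orb ` verts G" by (auto simp: vertex_orbits_def orbits_def orb_def)
  have part: "partition (verts G) ?O"
    unfolding vertex_orbits_def by (rule act.orbit_partition)
  have union: "\<Union> ?O = verts G" using partition.partition_coverture[OF part] .
  have finO: "finite A" if "A \<in> ?O" for A using fin that by (simp add: acts_finitely_def)
  have self: "x \<in> orb x" if "x \<in> verts G" for x
    unfolding orb_def by (rule act.orbit_refl[OF that])
  have orb_eq: "A = orb x" if "A \<in> ?O" "x \<in> A" for A x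
  proof -
    have x: "x \<in> verts G" using that union by blast
    then have "orb x \<in> ?O" using O by simp
    with that self[OF x] partition.unique_class[OF part x] show ?thesis by metis
  qed
  have nonempty: "A \<noteq> {}" if "A \<in> ?O" for A using that O self by auto
  have nonneg: "eweight G x y \<ge> 0" if "x \<in> verts G" "y \<in> verts G" for x y
    using that eweight_pos[of x y] eweight_zero[of x y] by (cases "{x, y} \<in> edges G") auto
  have sym_edge: "{x, y} \<in> edges G \<Longrightarrow> {y, x} \<in> edges G" for x y
    by (simp add: insert_commute)
  have edgeD: "A \<in> ?O \<and> B \<in> ?O \<and> A \<noteq> B \<and> (\<exists>x\<in>A. \<exists>y\<in>B. {x, y} \<in> edges G)"
    if "{A, B} \<in> edges (quotient_graph G \<Gamma>)" for A B
    using that by (auto simp: quotient_graph_def doubleton_eq_iff intro: sym_edge)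
  show ?thesis
  proof
    fix e assume "e \<in> edges (quotient_graph G \<Gamma>)"
    then show "\<exists>x\<in>verts (quotient_graph G \<Gamma>). \<exists>y\<in>verts (quotient_graph G \<Gamma>). x \<noteq> y \<and> e = {x, y}"
      by (auto simp: quotient_graph_def)
  next
    fix A assume "A \<in> verts (quotient_graph G \<Gamma>)"
    then have A: "A \<in> ?O" by (simp add: quotient_graph_def)
    have "{B. {A, B} \<in> edges (quotient_graph G \<Gamma>)} \<subseteq> orb ` (\<Union>x\<in>A. {y. {x, y} \<in> edges G})"
    proof
      fix B assume "B \<in> {B. {A, B} \<in> edges (quotient_graph G \<Gamma>)}"
      then obtain x y where "B \<in> ?O" "x \<in> A" "y \<in> B" "{x, y} \<in> edges G"
        using edgeD by blast
      then show "B \<in> orb ` (\<Union>x\<in>A. {y. {x, y} \<in> edges G})" using orb_eq by blast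
    qed
    moreover have "finite (\<Union>x\<in>A. {y. {x, y} \<in> edges G})"
      using A union by (intro finite_UN_I finO locally_finite) auto
    ultimately show "finite {B. {A, B} \<in> edges (quotient_graph G \<Gamma>)}"
      by (meson finite_imageI finite_subset)
    show "vweight (quotient_graph G \<Gamma>) A > 0"
      using A union finO nonempty by (auto simp: quotient_graph_def intro!: sum_pos vweight_pos)
  next
    fix A B assume "A \<in> verts (quotient_graph G \<Gamma>)" "B \<in> verts (quotient_graph G \<Gamma>)"
    then have AB: "A \<in> ?O" "B \<in> ?O" by (simp_all add: quotient_graph_def)
    have "(\<Sum>x\<in>A. \<Sum>y\<in>B. eweight G x y) = (\<Sum>x\<in>A. \<Sum>y\<in>B. eweight G y x)"
      using AB union by (intro sum.cong refl eweight_sym) auto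
    also have "\<dots> = (\<Sum>y\<in>B. \<Sum>x\<in>A. eweight G y x)" by (rule sum.swap)
    finally show "eweight (quotient_graph G \<Gamma>) A B = eweight (quotient_graph G \<Gamma>) B A"
      by (simp add: quotient_graph_def)
    assume "{A, B} \<notin> edges (quotient_graph G \<Gamma>)"
    then have "A = B \<or> (\<forall>x\<in>A. \<forall>y\<in>B. {x, y} \<notin> edges G)"
      using AB by (auto simp: quotient_graph_def)
    then show "eweight (quotient_graph G \<Gamma>) A B = 0"
    proof
      assume "\<forall>x\<in>A. \<forall>y\<in>B. {x, y} \<notin> edges G"
      then have "eweight G x y = 0" if "x \<in> A" "y \<in> B" for x y
        using that AB union by (intro eweight_zero) auto
      then show ?thesis by (simp add: quotient_graph_def)
    qed (simp add: quotient_graph_def)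
  next
    fix A B assume "{A, B} \<in> edges (quotient_graph G \<Gamma>)"
    then obtain x y where AB: "A \<in> ?O" "B \<in> ?O" "A \<noteq> B"
      and xy: "x \<in> A" "y \<in> B" "{x, y} \<in> edges G" using edgeD by blast
    have nn: "eweight G x' y' \<ge> 0" if "x' \<in> A" "y' \<in> B" for x' y'
      using that AB union by (intro nonneg) auto
    have "0 < (\<Sum>y\<in>B. eweight G x y)"
      using xy AB finO nn eweight_pos by (intro sum_pos2[of B y]) auto
    then have "0 < (\<Sum>x\<in>A. \<Sum>y\<in>B. eweight G x y)"
      using xy AB finO nn by (intro sum_pos2[of A x]) (auto intro!: sum_nonneg)
    then show "eweight (quotient_graph G \<Gamma>) A B > 0" using AB by (simp add: quotient_graph_def)
  next
    show "countable (verts (quotient_graph G \<Gamma>))"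
      using countable_verts by (simp add: quotient_graph_def O)
    have "infinite ?O"
    proof
      assume "finite ?O"
      then have "finite (\<Union> ?O)" using finO by blast
      then show False using union infinite_verts by simp
    qed
    then show "infinite (verts (quotient_graph G \<Gamma>))" by (simp add: quotient_graph_def)
  qed
qed

end

end

theory Submission
  imports Defs
begin

text \<open>The limits defining both constants may be computed along any exhaustion, so it suffices to
  use exhaustions of \<open>G\<close> by finite unions of orbits.  These are exactly the sets \<open>\<Union>\<W>\<close> with \<open>\<W>\<close>
  a finite set of vertices of the quotient, and the whole theorem reduces to the identity
  \<open>h(\<Union>\<W>) = h(\<W>)\<close> (lemma \<open>cheeger_on_Union\<close>).

  Weights in the quotient are sums over orbits, so \<open>\<U>\<close> and \<open>\<Union>\<U>\<close> have the same boundary size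
  and the same measure: the sets competing for \<open>h(\<W>)\<close> are the invariant ones among
  those competing for \<open>h(\<Union>\<W>)\<close>, whence \<open>h(\<Union>\<W>) \<le> h(\<W>)\<close>.

  For the converse it has to be shown that, on an invariant finite set \<open>W\<close>, the minimum defining
  \<open>h = h(W)\<close> is attained by an invariant set.  The boundary size is submodular and the measure is
  modular, so \<open>F(U) = |\<partial>U| - h |U|\<close> is submodular; on subsets of \<open>W\<close> it is nonnegative, and its
  zeros are the empty set and the minimizers.  Hence the zeros are closed under unions, and
  there is a largest minimizer \<open>M\<close> (lemma \<open>largest_cheeger_minimizer\<close>).  An automorphism that
  preserves \<open>W\<close> maps minimizers to minimizers, so it maps \<open>M\<close> into \<open>M\<close>: the set \<open>M\<close>
  is a union of orbits.\<close>

section \<open>Submodularity of the boundary size and the largest minimizer\<close>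

context weighted_graph
begin

lemma eweight_nonneg: "\<lbrakk>x \<in> verts G; y \<in> verts G\<rbrakk> \<Longrightarrow> eweight G x y \<ge> 0"
  using eweight_pos[of x y] eweight_zero[of x y] by (cases "{x, y} \<in> edges G") auto

text \<open>The boundary of a set only involves edges into its neighbourhood.  Cutting the double sum
  down to a finite set \<open>T\<close> that contains this neighbourhood makes boundary sizes accessible to
  manipulations of finite sums, and one \<open>T\<close> can serve several sets \<open>U\<close> at once.\<close>

lemma boundary_size_eq_sum:
  assumes T: "finite T" "T \<subseteq> verts G" and U: "U \<subseteq> T"
    and nbh: "\<And>x y. \<lbrakk>x \<in> U; {x, y} \<in> edges G\<rbrakk> \<Longrightarrow> y \<in> T"
  shows "boundary_size G U = (\<Sum>x\<in>U. \<Sum>y\<in>T - U. eweight G x y)"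
proof -
  let ?D = "{(x, y). x \<in> U \<and> y \<in> T - U \<and> {x, y} \<in> edges G}"
  have finU: "finite U" using T U by (rule_tac finite_subset)
  have bd: "edge_boundary G U = (\<lambda>(x, y). {x, y}) ` ?D"
    using nbh T by (fastforce simp: edge_boundary_def)
  have inj: "inj_on (\<lambda>(x, y). {x, y}) ?D"
    by (auto simp: inj_on_def doubleton_eq_iff)
  have "boundary_size G U = (\<Sum>(x, y)\<in>?D. eweight G x y)"
    unfolding boundary_size_def bd sum.reindex[OF inj]
    by (rule sum.cong) (auto simp: edge_weight_eq)
  also have "\<dots> = (\<Sum>(x, y)\<in>U \<times> (T - U). eweight G x y)"
    using T U finU by (intro sum.mono_neutral_left) (auto intro!: eweight_zero)
  also have "\<dots> = (\<Sum>x\<in>U. \<Sum>y\<in>T - U. eweight G x y)"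
    by (simp add: sum.cartesian_product)
  finally show ?thesis .
qed

lemma finite_neighbourhood_superset:
  assumes "finite W" "W \<subseteq> verts G"
  obtains T where "finite T" "T \<subseteq> verts G" "W \<subseteq> T"
    "\<And>x y. \<lbrakk>x \<in> W; {x, y} \<in> edges G\<rbrakk> \<Longrightarrow> y \<in> T"
proof
  let ?T = "W \<union> (\<Union>x\<in>W. {y. {x, y} \<in> edges G})"
  show "finite ?T" using assms locally_finite by auto
  show "?T \<subseteq> verts G" using assms edge_verts by auto
qed auto

text \<open>The inequality already holds for each ordered pair \<open>(x, y)\<close> separately: a pair that leaves
  \<open>A \<union> B\<close> or \<open>A \<inter> B\<close> leaves \<open>A\<close> or \<open>B\<close>, and a pair that leaves both of the former leaves both of
  the latter.\<close>

lemma boundary_size_submodular: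
  assumes fin: "finite A" "finite B" and sub: "A \<subseteq> verts G" "B \<subseteq> verts G"
  shows "boundary_size G (A \<union> B) + boundary_size G (A \<inter> B)
    \<le> boundary_size G A + boundary_size G B"
proof -
  obtain T where T: "finite T" "T \<subseteq> verts G" "A \<union> B \<subseteq> T"
    and nbh: "\<And>x y. \<lbrakk>x \<in> A \<union> B; {x, y} \<in> edges G\<rbrakk> \<Longrightarrow> y \<in> T"
    using finite_neighbourhood_superset[of "A \<union> B"] assms by (metis finite_UnI Un_least)
  define c where "c U x y = (if x \<in> U \<and> y \<notin> U then eweight G x y else 0)" for U x y
  have bs: "boundary_size G U = (\<Sum>x\<in>T. \<Sum>y\<in>T. c U x y)" if U: "U \<subseteq> A \<union> B" for U
  proof -
    have "boundary_size G U = (\<Sum>x\<in>U. \<Sum>y\<in>T - U. eweight G x y)"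
      using T U nbh by (intro boundary_size_eq_sum) blast+
    also have "\<dots> = (\<Sum>x\<in>U. \<Sum>y\<in>T. c U x y)"
      using T by (intro sum.cong refl sum.mono_neutral_cong_left) (auto simp: c_def)
    also have "\<dots> = (\<Sum>x\<in>T. \<Sum>y\<in>T. c U x y)"
      using T U by (intro sum.mono_neutral_left) (auto simp: c_def)
    finally show ?thesis .
  qed
  have "(\<Sum>x\<in>T. \<Sum>y\<in>T. c (A \<union> B) x y + c (A \<inter> B) x y) \<le> (\<Sum>x\<in>T. \<Sum>y\<in>T. c A x y + c B x y)"
    using T eweight_nonneg by (intro sum_mono) (auto simp: c_def subset_iff)
  then show ?thesis by (simp add: bs sum.distrib le_infI1)
qed

lemma vertex_size_pos: "\<lbrakk>finite U; U \<noteq> {}; U \<subseteq> verts G\<rbrakk> \<Longrightarrow> vertex_size G U > 0"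
  unfolding vertex_size_def by (rule sum_pos) (auto intro: vweight_pos)

lemma cheeger_on_le:
  "\<lbrakk>finite W; U \<noteq> {}; U \<subseteq> W\<rbrakk> \<Longrightarrow> cheeger_on G W \<le> boundary_size G U / vertex_size G U"
  unfolding cheeger_on_def by (intro Min_le finite_ratios) auto

text \<open>The form without division includes \<open>U = {}\<close>, which occurs as the intersection of two disjoint
  minimizers.\<close>

lemma cheeger_on_mult_le:
  assumes "finite W" "W \<subseteq> verts G" "U \<subseteq> W"
  shows "cheeger_on G W * vertex_size G U \<le> boundary_size G U"
proof (cases "U = {}")
  case True
  then show ?thesis by (simp add: boundary_size_nonneg vertex_size_def)
next
  case False
  with assms have "vertex_size G U > 0" by (intro vertex_size_pos) (auto intro: finite_subset)
  then show ?thesis using cheeger_on_le[of W U] False assms by (simp add: le_divide_eq)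
qed

lemma cheeger_on_attained:
  assumes "finite W" "W \<noteq> {}"
  obtains U where "U \<noteq> {}" "U \<subseteq> W" "cheeger_on G W = boundary_size G U / vertex_size G U"
proof -
  let ?R = "(\<lambda>U. boundary_size G U / vertex_size G U) ` {U. U \<noteq> {} \<and> U \<subseteq> W}"
  have "cheeger_on G W \<in> ?R"
    unfolding cheeger_on_def using assms by (intro Min_in finite_ratios) auto
  then show ?thesis using that by auto
qed

text \<open>If \<open>A\<close> and \<open>B\<close> satisfy \<open>|\<partial>U| = h |U|\<close>, then by submodularity the inequalities \<open>|\<partial>U| \<ge> h |U|\<close>
  for \<open>A \<union> B\<close> and \<open>A \<inter> B\<close> sum to an equality, so both are equalities.\<close>

lemma largest_cheeger_minimizer:
  assumes W: "finite W" "W \<noteq> {}" "W \<subseteq> verts G"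
  obtains M where "M \<noteq> {}" "M \<subseteq> W"
    "boundary_size G M = cheeger_on G W * vertex_size G M"
    "\<And>U. \<lbrakk>U \<subseteq> W; boundary_size G U = cheeger_on G W * vertex_size G U\<rbrakk> \<Longrightarrow> U \<subseteq> M"
proof -
  let ?h = "cheeger_on G W"
  let ?Z = "{U. U \<subseteq> W \<and> boundary_size G U = ?h * vertex_size G U}"
  have fin: "finite U" and verts: "U \<subseteq> verts G" if "U \<subseteq> W" for U
    using that W by (auto intro: finite_subset)
  obtain U0 where U0: "U0 \<noteq> {}" "U0 \<subseteq> W" "?h = boundary_size G U0 / vertex_size G U0"
    using cheeger_on_attained W by blast
  have "vertex_size G U0 > 0" using vertex_size_pos fin verts U0 by blast
  then have U0Z: "U0 \<in> ?Z" using U0 by simp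
  have union: "A \<union> B \<in> ?Z" if "A \<in> ?Z" "B \<in> ?Z" for A B
  proof -
    from that have AB: "A \<subseteq> W" "B \<subseteq> W" "A \<union> B \<subseteq> W" "A \<inter> B \<subseteq> W" by auto
    have "vertex_size G (A \<union> B) + vertex_size G (A \<inter> B) = vertex_size G A + vertex_size G B"
      unfolding vertex_size_def using fin AB by (intro sum.union_inter) auto
    then have "?h * vertex_size G (A \<union> B) + ?h * vertex_size G (A \<inter> B)
        = boundary_size G A + boundary_size G B"
      using that by (simp flip: distrib_left)
    moreover have "boundary_size G (A \<union> B) + boundary_size G (A \<inter> B)
        \<le> boundary_size G A + boundary_size G B"
      using AB fin verts by (intro boundary_size_submodular) auto
    ultimately have "boundary_size G (A \<union> B) = ?h * vertex_size G (A \<union> B)"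
      using cheeger_on_mult_le[OF W(1,3) AB(3)] cheeger_on_mult_le[OF W(1,3) AB(4)] by linarith
    then show ?thesis using AB by simp
  qed
  \<comment> \<open>In a family closed under unions, a maximal member is the largest one.\<close>
  have "finite ?Z" using W by (intro finite_subset[of ?Z "Pow W"]) auto
  moreover have "?Z \<noteq> {}" using U0Z by (metis empty_iff)
  ultimately have "\<exists>M\<in>?Z. \<forall>U\<in>?Z. M \<subseteq> U \<longrightarrow> M = U" by (rule finite_has_maximal)
  then obtain M where M: "M \<in> ?Z" and max: "\<And>U. U \<in> ?Z \<Longrightarrow> M \<subseteq> U \<Longrightarrow> M = U"
    by (elim bexE) simp
  have largest: "U \<subseteq> M" if "U \<in> ?Z" for U
  proof -
    have "M = M \<union> U" using union[OF M that] by (rule max) simp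
    then show ?thesis by blast
  qed
  show ?thesis
  proof
    show "M \<noteq> {}" using largest[OF U0Z] U0 by blast
  qed (use M largest in auto)
qed

lemma
  assumes g: "g \<in> graph_auto G" and U: "finite U" "U \<subseteq> verts G"
  shows boundary_size_image: "boundary_size G (g ` U) = boundary_size G U"
    and vertex_size_image: "vertex_size G (g ` U) = vertex_size G U"
proof -
  have bij: "bij_betw g (verts G) (verts G)"
    and e: "\<And>x y. \<lbrakk>x \<in> verts G; y \<in> verts G\<rbrakk> \<Longrightarrow> {g x, g y} \<in> edges G \<longleftrightarrow> {x, y} \<in> edges G"
    and w: "\<And>x y. \<lbrakk>x \<in> verts G; y \<in> verts G\<rbrakk> \<Longrightarrow> eweight G (g x) (g y) = eweight G x y"
    and v: "\<And>x. x \<in> verts G \<Longrightarrow> vweight G (g x) = vweight G x"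
    using g by (auto simp: graph_auto_def Bij_def)
  have inj: "inj_on g X" if "X \<subseteq> verts G" for X
    using bij that by (auto simp: bij_betw_def intro: inj_on_subset)
  have img: "g ` verts G = verts G" using bij by (simp add: bij_betw_def)
  obtain T where T: "finite T" "T \<subseteq> verts G" "U \<subseteq> T"
    and nbh: "\<And>x y. \<lbrakk>x \<in> U; {x, y} \<in> edges G\<rbrakk> \<Longrightarrow> y \<in> T"
    using finite_neighbourhood_superset[OF U] by blast
  have "boundary_size G (g ` U) = (\<Sum>x\<in>g ` U. \<Sum>y\<in>g ` T - g ` U. eweight G x y)"
  proof (rule boundary_size_eq_sum)
    fix x y assume "x \<in> g ` U" and xy: "{x, y} \<in> edges G"
    then obtain x' where x': "x' \<in> U" "x = g x'" by blast
    have "y \<in> g ` verts G" using edge_verts[OF xy] img by simp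
    then obtain y' where "y' \<in> verts G" "y = g y'" by blast
    then show "y \<in> g ` T" using e[of x' y'] x' xy U nbh by auto
  qed (use T img in auto)
  also have "g ` T - g ` U = g ` (T - U)"
    using inj_on_image_set_diff[OF inj[OF subset_refl], of T U] T by auto
  also have "(\<Sum>x\<in>g ` U. \<Sum>y\<in>g ` (T - U). eweight G x y) = (\<Sum>x\<in>U. \<Sum>y\<in>T - U. eweight G (g x) (g y))"
    using T U by (subst (1 2) sum.reindex) (auto intro: inj)
  also have "\<dots> = (\<Sum>x\<in>U. \<Sum>y\<in>T - U. eweight G x y)"
    using T by (intro sum.cong refl w) auto
  also have "\<dots> = boundary_size G U" using boundary_size_eq_sum[OF T nbh] by simp
  finally show "boundary_size G (g ` U) = boundary_size G U" .
  show "vertex_size G (g ` U) = vertex_size G U"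
    unfolding vertex_size_def using U by (subst sum.reindex) (auto intro!: inj sum.cong v)
qed

end


section \<open>Cheeger constants of finite unions of orbits\<close>

locale finite_graph_action = infinite_weighted_graph +
  fixes \<Gamma> :: "('a \<Rightarrow> 'a) set"
  assumes subgroup: "subgroup \<Gamma> (graph_AutoGroup G)"
    and acts_finitely: "acts_finitely \<Gamma> G"
begin

sublocale quotient: infinite_weighted_graph "quotient_graph G \<Gamma>"
  by (rule infinite_weighted_graph_quotient[OF subgroup acts_finitely])

abbreviation "V_quot \<equiv> vertex_orbits G \<Gamma>"

lemma verts_quotient: "verts (quotient_graph G \<Gamma>) = V_quot"
  by (simp add: quotient_graph_def)

lemma automorphism: "g \<in> \<Gamma> \<Longrightarrow> g \<in> graph_auto G"
  using subgroup.subset[OF subgroup] by (auto simp: graph_AutoGroup_def)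

lemma vertex_orbits_eq: "V_quot = (\<lambda>x. {g x | g. g \<in> \<Gamma>}) ` verts G"
  by (auto simp: vertex_orbits_def orbits_def orbit_def)

lemma vertex_orbits_partition: "partition (verts G) V_quot"
  unfolding vertex_orbits_def by (rule group_action.orbit_partition[OF subgroup_action[OF subgroup]])

lemma Union_vertex_orbits: "\<Union> V_quot = verts G"
  using partition.partition_coverture[OF vertex_orbits_partition] .

lemma Union_orbits_subset: "\<W> \<subseteq> V_quot \<Longrightarrow> \<Union>\<W> \<subseteq> verts G"
  using Union_vertex_orbits by blast

lemma finite_vertex_orbit: "A \<in> V_quot \<Longrightarrow> finite A"
  using acts_finitely by (simp add: acts_finitely_def)

lemma finite_Union_orbits: "\<lbrakk>finite \<W>; \<W> \<subseteq> V_quot\<rbrakk> \<Longrightarrow> finite (\<Union>\<W>)"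
  by (auto intro: finite_vertex_orbit)

lemma vertex_orbits_disjoint:
  assumes "A \<in> V_quot" "B \<in> V_quot" "x \<in> A" "x \<in> B"
  shows "A = B"
proof -
  have "x \<in> verts G" using assms Union_vertex_orbits by blast
  then show ?thesis using partition.unique_class[OF vertex_orbits_partition] assms by blast
qed

lemma vertex_orbit_nonempty: "A \<in> V_quot \<Longrightarrow> A \<noteq> {}"
  using subgroup.one_closed[OF subgroup] by (auto simp: vertex_orbits_eq)

lemma Union_orbits_diff:
  "\<lbrakk>\<T> \<subseteq> V_quot; \<W> \<subseteq> V_quot\<rbrakk> \<Longrightarrow> \<Union>\<T> - \<Union>\<W> = \<Union>(\<T> - \<W>)"
  using vertex_orbits_disjoint by blast

lemma sum_Union_orbits:
  assumes "\<W> \<subseteq> V_quot"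
  shows "sum f (\<Union>\<W>) = (\<Sum>A\<in>\<W>. sum f A)"
proof -
  have "\<forall>A\<in>\<W>. finite A" using assms finite_vertex_orbit by auto
  moreover have "\<forall>A\<in>\<W>. \<forall>B\<in>\<W>. A \<noteq> B \<longrightarrow> A \<inter> B = {}"
  proof (intro ballI impI equals0I)
    fix A B x assume "A \<in> \<W>" "B \<in> \<W>" "A \<noteq> B" "x \<in> A \<inter> B"
    then show False using vertex_orbits_disjoint[of A B x] assms by auto
  qed
  ultimately show ?thesis by (simp add: sum.Union_disjoint)
qed

lemma image_Union_orbits:
  assumes g: "g \<in> \<Gamma>" and \<W>: "\<W> \<subseteq> V_quot"
  shows "g ` \<Union>\<W> \<subseteq> \<Union>\<W>"
proof
  fix y assume "y \<in> g ` \<Union>\<W>"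
  then obtain A x where A: "A \<in> \<W>" "x \<in> A" "y = g x" by blast
  then have "x \<in> verts G" using \<W> Union_orbits_subset by blast
  then have orb: "{h x | h. h \<in> \<Gamma>} \<in> V_quot" by (auto simp: vertex_orbits_eq)
  have "x \<in> {h x | h. h \<in> \<Gamma>}"
    using group_action.orbit_refl[OF subgroup_action[OF subgroup] \<open>x \<in> verts G\<close>]
    by (simp add: orbit_def)
  then have "A = {h x | h. h \<in> \<Gamma>}" using A \<W> orb vertex_orbits_disjoint by blast
  then show "y \<in> \<Union>\<W>" using A g by blast
qed

lemma invariant_eq_Union_orbits:
  assumes M: "M \<subseteq> verts G" and inv: "\<And>g. g \<in> \<Gamma> \<Longrightarrow> g ` M \<subseteq> M"
  shows "M = \<Union>{A \<in> V_quot. A \<subseteq> M}"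
proof -
  have "x \<in> \<Union>{A \<in> V_quot. A \<subseteq> M}" if x: "x \<in> M" for x
  proof -
    have "x \<in> {g x | g. g \<in> \<Gamma>}"
      using group_action.orbit_refl[OF subgroup_action[OF subgroup], of x] x M
      by (auto simp: orbit_def)
    moreover have "{g x | g. g \<in> \<Gamma>} \<subseteq> M" using inv x by blast
    moreover have "{g x | g. g \<in> \<Gamma>} \<in> V_quot" using x M by (auto simp: vertex_orbits_eq)
    ultimately show ?thesis by blast
  qed
  then show ?thesis by blast
qed

lemma vertex_size_Union:
  "\<W> \<subseteq> V_quot \<Longrightarrow> vertex_size G (\<Union>\<W>) = vertex_size (quotient_graph G \<Gamma>) \<W>"
  by (simp add: vertex_size_def sum_Union_orbits quotient_graph_def)

text \<open>Edges inside an orbit are lost in the quotient, but they never lie in the boundary of a union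
  of orbits.\<close>

lemma boundary_size_Union:
  assumes \<U>: "finite \<U>" "\<U> \<subseteq> V_quot"
  shows "boundary_size G (\<Union>\<U>) = boundary_size (quotient_graph G \<Gamma>) \<U>"
proof -
  obtain \<T> where T: "finite \<T>" "\<T> \<subseteq> V_quot" "\<U> \<subseteq> \<T>"
    and nbh: "\<And>A B. \<lbrakk>A \<in> \<U>; {A, B} \<in> edges (quotient_graph G \<Gamma>)\<rbrakk> \<Longrightarrow> B \<in> \<T>"
    using quotient.finite_neighbourhood_superset \<U> unfolding verts_quotient by metis
  have "boundary_size G (\<Union>\<U>) = (\<Sum>x\<in>\<Union>\<U>. \<Sum>y\<in>\<Union>\<T> - \<Union>\<U>. eweight G x y)"
  proof (rule boundary_size_eq_sum)
    fix x y assume "x \<in> \<Union>\<U>" and xy: "{x, y} \<in> edges G"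
    then obtain A where A: "A \<in> \<U>" "x \<in> A" by blast
    have "y \<in> \<Union> V_quot" using edge_verts[OF xy] Union_vertex_orbits by simp
    then obtain B where B: "B \<in> V_quot" "y \<in> B" by blast
    have "B \<in> \<T>"
    proof (cases "A = B")
      case False
      moreover have "A \<in> V_quot" using A \<U> by blast
      ultimately have "{A, B} \<in> edges (quotient_graph G \<Gamma>)"
        using A B xy unfolding quotient_graph_def by fastforce
      then show ?thesis using nbh A by blast
    qed (use A T in blast)
    then show "y \<in> \<Union>\<T>" using B by blast
  qed (use T finite_Union_orbits Union_orbits_subset in auto)
  also have "\<dots> = (\<Sum>A\<in>\<U>. \<Sum>x\<in>A. \<Sum>B\<in>\<T> - \<U>. \<Sum>y\<in>B. eweight G x y)"
  proof -
    have "\<T> - \<U> \<subseteq> V_quot" using T by blast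
    then show ?thesis by (simp add: Union_orbits_diff[OF T(2) \<U>(2)] sum_Union_orbits \<U>)
  qed
  also have "\<dots> = (\<Sum>A\<in>\<U>. \<Sum>B\<in>\<T> - \<U>. \<Sum>x\<in>A. \<Sum>y\<in>B. eweight G x y)"
    by (intro sum.cong refl sum.swap)
  also have "\<dots> = (\<Sum>A\<in>\<U>. \<Sum>B\<in>\<T> - \<U>. eweight (quotient_graph G \<Gamma>) A B)"
    by (intro sum.cong refl) (auto simp: quotient_graph_def)
  also have "\<dots> = boundary_size (quotient_graph G \<Gamma>) \<U>"
    using T nbh by (intro quotient.boundary_size_eq_sum[symmetric]) (auto simp: verts_quotient)
  finally show ?thesis .
qed

text \<open>Minimizing over invariant sets only costs nothing: the largest minimizer is
  characterized by \<open>W\<close> alone, so every symmetry of \<open>W\<close> preserves it.\<close>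

lemma cheeger_on_Union:
  assumes \<W>: "finite \<W>" "\<W> \<subseteq> V_quot"
  shows "cheeger_on G (\<Union>\<W>) = cheeger_on (quotient_graph G \<Gamma>) \<W>"
proof (cases "\<W> = {}")
  case True
  \<comment> \<open>Both sides are the unspecified minimum of the empty set of reals.\<close>
  then show ?thesis by (simp add: cheeger_on_def)
next
  case nonempty: False
  let ?W = "\<Union>\<W>" and ?Q = "quotient_graph G \<Gamma>"
  have W: "finite ?W" "?W \<noteq> {}" "?W \<subseteq> verts G"
  proof -
    show "finite ?W" "?W \<subseteq> verts G"
      using \<W> by (simp_all only: finite_Union_orbits Union_orbits_subset)
    show "?W \<noteq> {}" using nonempty \<W>(2) vertex_orbit_nonempty by fastforce
  qed
  have ratio: "boundary_size ?Q \<U> / vertex_size ?Q \<U>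
      = boundary_size G (\<Union>\<U>) / vertex_size G (\<Union>\<U>)" if "\<U> \<subseteq> \<W>" for \<U>
  proof -
    have "finite \<U>" "\<U> \<subseteq> V_quot" using that \<W> by (auto intro: finite_subset)
    then show ?thesis by (simp add: boundary_size_Union vertex_size_Union)
  qed
  show ?thesis
  proof (rule antisym)
    obtain \<U> where \<U>: "\<U> \<noteq> {}" "\<U> \<subseteq> \<W>"
      and eq: "cheeger_on ?Q \<W> = boundary_size ?Q \<U> / vertex_size ?Q \<U>"
      using quotient.cheeger_on_attained \<W>(1) nonempty by blast
    have "\<Union>\<U> \<noteq> {}" using \<U> \<W>(2) vertex_orbit_nonempty by fastforce
    moreover have "\<Union>\<U> \<subseteq> ?W" using \<U>(2) by (rule Union_mono)
    ultimately have "cheeger_on G ?W \<le> boundary_size G (\<Union>\<U>) / vertex_size G (\<Union>\<U>)"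
      by (rule cheeger_on_le[OF W(1)])
    then show "cheeger_on G ?W \<le> cheeger_on ?Q \<W>"
      using eq ratio[OF \<U>(2)] by simp
  next
    obtain M where M: "M \<noteq> {}" "M \<subseteq> ?W" "boundary_size G M = cheeger_on G ?W * vertex_size G M"
      and largest: "\<And>U. \<lbrakk>U \<subseteq> ?W; boundary_size G U = cheeger_on G ?W * vertex_size G U\<rbrakk> \<Longrightarrow> U \<subseteq> M"
      using largest_cheeger_minimizer[OF W] by blast
    have finM: "finite M" "M \<subseteq> verts G"
      using M(2) W by (auto intro: finite_subset)
    define \<M> where "\<M> = {A \<in> V_quot. A \<subseteq> M}"
    have "g ` M \<subseteq> M" if g: "g \<in> \<Gamma>" for g
    proof (rule largest)
      show "g ` M \<subseteq> ?W" using image_Union_orbits[OF g \<W>(2)] M(2) by blast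
      show "boundary_size G (g ` M) = cheeger_on G ?W * vertex_size G (g ` M)"
        using M boundary_size_image[OF automorphism[OF g] finM]
          vertex_size_image[OF automorphism[OF g] finM] by simp
    qed
    then have M_eq: "M = \<Union>\<M>"
      unfolding \<M>_def using finM(2) by (intro invariant_eq_Union_orbits)
    have sub: "\<M> \<subseteq> \<W>"
    proof
      fix A assume A: "A \<in> \<M>"
      then obtain x where "x \<in> A" using vertex_orbit_nonempty by (auto simp: \<M>_def)
      moreover from this A M(2) obtain B where "B \<in> \<W>" "x \<in> B" by (auto simp: \<M>_def)
      ultimately show "A \<in> \<W>" using A \<W> vertex_orbits_disjoint by (auto simp: \<M>_def)
    qed
    have "\<M> \<noteq> {}" using M(1) M_eq by auto
    from quotient.cheeger_on_le[OF \<W>(1) this sub]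
    have "cheeger_on ?Q \<W> \<le> boundary_size G M / vertex_size G M"
      using ratio[OF sub] M_eq by simp
    also have "\<dots> = cheeger_on G ?W" using M vertex_size_pos[OF finM(1) M(1) finM(2)] by simp
    finally show "cheeger_on ?Q \<W> \<le> cheeger_on G ?W" .
  qed
qed


section \<open>Passing to the limit\<close>

lemma exhaustion_Union:
  assumes ex: "exhaustion (quotient_graph G \<Gamma>) \<Omega>"
  shows "exhaustion G (\<lambda>i. \<Union>(\<Omega> i))"
  unfolding exhaustion_def
proof (intro conjI allI)
  have \<Omega>: "finite (\<Omega> i)" "\<Omega> i \<subseteq> V_quot" for i
    using exhaustion_finite[OF ex] exhaustion_subset[OF ex] by (auto simp: verts_quotient)
  then show "finite (\<Union>(\<Omega> i))" for i by (rule finite_Union_orbits)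
  show "\<Union>(\<Omega> i) \<subseteq> \<Union>(\<Omega> (Suc i))" for i
    using ex by (intro Union_mono) (simp add: exhaustion_def)
  have "(\<Union>i. \<Union>(\<Omega> i)) = \<Union>(\<Union>i. \<Omega> i)" by blast
  also have "(\<Union>i. \<Omega> i) = V_quot" using ex by (simp add: exhaustion_def verts_quotient)
  finally show "(\<Union>i. \<Union>(\<Omega> i)) = verts G" using Union_vertex_orbits by simp
qed

lemma cheeger_quotient: "cheeger G = cheeger (quotient_graph G \<Gamma>)"
proof -
  obtain \<Omega> where ex: "exhaustion (quotient_graph G \<Gamma>) \<Omega>" using quotient.exhaustion_exists ..
  have "cheeger_on G (\<Union>(\<Omega> i)) = cheeger_on (quotient_graph G \<Gamma>) (\<Omega> i)" for i
    using exhaustion_finite[OF ex] exhaustion_subset[OF ex]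
    by (intro cheeger_on_Union) (auto simp: verts_quotient)
  then have "(\<lambda>i. cheeger_on (quotient_graph G \<Gamma>) (\<Omega> i)) \<longlonglongrightarrow> cheeger G"
    using cheeger_limit[OF exhaustion_Union[OF ex]] by simp
  then show ?thesis using quotient.cheeger_limit[OF ex] LIMSEQ_unique by blast
qed

lemma cheeger_infinity_quotient: "cheeger_infinity G = cheeger_infinity (quotient_graph G \<Gamma>)"
proof -
  let ?Q = "quotient_graph G \<Gamma>"
  obtain \<Omega> where ex: "exhaustion ?Q \<Omega>" using quotient.exhaustion_exists ..
  have \<Omega>: "finite (\<Omega> i)" "\<Omega> i \<subseteq> V_quot" for i
    using exhaustion_finite[OF ex] exhaustion_subset[OF ex] by (auto simp: verts_quotient)
  have eq: "cheeger_on G (\<Union>(\<Omega> j) - \<Union>(\<Omega> i)) = cheeger_on ?Q (\<Omega> j - \<Omega> i)" for i j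
    unfolding Union_orbits_diff[OF \<Omega>(2) \<Omega>(2)] using \<Omega> by (intro cheeger_on_Union) auto
  obtain L where L: "\<And>i. (\<lambda>j. cheeger_on ?Q (\<Omega> j - \<Omega> i)) \<longlonglongrightarrow> L i"
    and L_lim: "(\<lambda>i. ereal (L i)) \<longlonglongrightarrow> cheeger_infinity G"
    using cheeger_infinity_limit[OF exhaustion_Union[OF ex]] unfolding eq by blast
  obtain L' where L': "\<And>i. (\<lambda>j. cheeger_on ?Q (\<Omega> j - \<Omega> i)) \<longlonglongrightarrow> L' i"
    and L'_lim: "(\<lambda>i. ereal (L' i)) \<longlonglongrightarrow> cheeger_infinity ?Q"
    using quotient.cheeger_infinity_limit[OF ex] by blast
  have "L = L'" using LIMSEQ_unique[OF L L'] by auto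
  then show ?thesis using L_lim L'_lim LIMSEQ_unique by blast
qed

end

theorem theorem1p3:
  fixes G :: "'a weighted_graph" and \<Gamma> :: "('a \<Rightarrow> 'a) set"
  assumes "infinite_weighted_graph G"
    and "subgroup \<Gamma> (graph_AutoGroup G)"
    and "acts_finitely \<Gamma> G"
  shows "cheeger G = cheeger (quotient_graph G \<Gamma>) \<and>
         cheeger_infinity G = cheeger_infinity (quotient_graph G \<Gamma>)"
proof -
  interpret finite_graph_action G \<Gamma>
    using assms by (simp add: finite_graph_action_def finite_graph_action_axioms_def)
  show ?thesis using cheeger_quotient cheeger_infinity_quotient by simp
qed

end
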